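(* Let $\mathfrak{g}$ be a finite-dimensional perfect Lie algebra over an arbitrary field of characteristic zero. Then any $A_{BD}$-structure on $\mathfrak{g}$ is trivial; that is, if $\circ$ is an $A_{BD}$-structure on $\mathfrak{g}$, then $x\circ y=0$ for all $x,y\in\mathfrak{g}$.
   Context: A Lie algebra $\mathfrak{g}$ is perfect if $[\mathfrak{g},\mathfrak{g}]=\mathfrak{g}$. An $A_{BD}$-structure on a Lie algebra $\mathfrak{g}$ is a commutative bilinear product $\circ:\mathfrak{g}\times\mathfrak{g}\to\mathfrak{g}$ with $x\circ[y,z]=[x\circ y,z]+[y,x\circ z]$ for all $x,y,z\in\mathfrak{g}$. It is called trivial if it is identically zero. *)

theory Defs
  imports Complex_Main
begin

definition bilinear_map ::
    "('k::field \<Rightarrow> 'g::ab_group_add \<Rightarrow> 'g) \<Rightarrow> ('g \<Rightarrow> 'g \<Rightarrow> 'g) \<Rightarrow> bool" where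
  "bilinear_map scale f \<longleftrightarrow>
     (\<forall>x. Vector_Spaces.linear scale scale (\<lambda>y. f x y)) \<and>
     (\<forall>y. Vector_Spaces.linear scale scale (\<lambda>x. f x y))"

text \<open>The underlying vector space of a Lie algebra is the whole type \<open>'g\<close>, with scalar
  multiplication \<open>scale\<close> by elements of the field \<open>'k\<close>.\<close>

locale lie_algebra = vector_space scale
  for scale :: "'k::field \<Rightarrow> 'g::ab_group_add \<Rightarrow> 'g" +
  fixes bracket :: "'g \<Rightarrow> 'g \<Rightarrow> 'g"
  assumes bilinear_bracket: "bilinear_map scale bracket"
    and bracket_self: "bracket x x = 0"
    and jacobi: "bracket x (bracket y z) + bracket y (bracket z x) + bracket z (bracket x y) = 0"
begin

definition derived_algebra :: "'g set" where
  "derived_algebra = span {bracket x y | x y. True}"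

definition perfect :: bool where
  "perfect \<longleftrightarrow> derived_algebra = UNIV"

definition ABD_structure :: "('g \<Rightarrow> 'g \<Rightarrow> 'g) \<Rightarrow> bool" where
  "ABD_structure m \<longleftrightarrow>
     bilinear_map scale m \<and>
     (\<forall>x y. m x y = m y x) \<and>
     (\<forall>x y z. m x (bracket y z) = bracket (m x y) z + bracket y (m x z))"

end

end

theory Submission
  imports Defs "HOL-Library.Function_Algebras"
begin

text \<open>
  An \<open>A\<^sub>B\<^sub>D\<close>-structure is a symmetric biderivation, so \<open>x \<mapsto> m x d\<close> is a 1-cocycle:
  \<open>m [x,y] d = [x, m y d] - [y, m x d]\<close> (\<open>ABD_cocycle\<close>). Expanding \<open>m [a,c] [b,d]\<close> with the
  cocycle rule in both orders and comparing yields \<open>[[a,b], m c d] + (cyclic in a, b, c) = 0\<close>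
  (\<open>ABD_triangle\<close>), and differentiating this identity shows that the standard polynomial
  \<open>[a,b] c + [b,c] a + [c,a] b\<close> in \<open>ad a\<close>, \<open>ad b\<close>, \<open>ad c\<close> kills every product
  \<open>m x d\<close> (\<open>cubic_ABD\<close>). Hence it kills the ideal \<open>J\<close> generated by all products. Since the
  algebra is perfect, the cocycle rule also gives \<open>J = [g, J]\<close> (\<open>ABD_ideal_generated\<close>).

  It remains to see that a perfect Lie algebra cannot act with \<open>g J = J\<close> on a nonzero
  finite-dimensional space if the standard polynomial of degree three vanishes on the acting
  operators. Let \<open>t (x\<^sub>1, \<dots>, x\<^sub>n)\<close> be the trace of \<open>x\<^sub>1 \<cdots> x\<^sub>n\<close>.
  By induction on \<open>n \<ge> 1\<close> all these traces vanish (\<open>cyclic_functional_vanishes\<close>): when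
  the shorter ones do, \<open>t\<close> is symmetric in its arguments; ad-invariance of \<open>t\<close> and the cubic
  identity then say that \<open>(a, b) \<mapsto> t ([a,b], \<dots>)\<close>, read as a flow along the edges of a
  complete graph whose vertices are the arguments, is both divergence free and curl free, hence
  zero in characteristic zero. So the associative algebra generated by the operators, without
  unit, consists of traceless operators. Such an algebra is nil, because a non-nilpotent element
  would have a nonzero idempotent among its polynomials without constant term, with trace its rank
  (\<open>nilpotent_of_traceless_algebra\<close>). A nil algebra maps \<open>J\<close> into any maximal proper
  submodule of \<open>J\<close>, contradicting \<open>g J = J\<close> unless \<open>J = 0\<close>
  (\<open>generated_submodule_trivial\<close>).
\<close>

section \<open>Traces of endomorphisms\<close>

locale char_0_space = finite_dimensional_vector_space scale Basis
  for scale :: "'k::field_char_0 \<Rightarrow> 'v::ab_group_add \<Rightarrow> 'v" (infixr \<open>*s\<close> 75) and Basis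
begin

sublocale endo: vector_space_pair scale scale
  by unfold_locales

abbreviation endomorphism :: "('v \<Rightarrow> 'v) \<Rightarrow> bool" where
  "endomorphism \<equiv> Vector_Spaces.linear scale scale"

definition trace_wrt :: "'v set \<Rightarrow> ('v \<Rightarrow> 'v) \<Rightarrow> 'k" where
  "trace_wrt B f = (\<Sum>b\<in>B. representation B (f b) b)"

abbreviation trace :: "('v \<Rightarrow> 'v) \<Rightarrow> 'k" where
  "trace \<equiv> trace_wrt Basis"

text \<open>Allowing two different bases gives commutativity of the trace and, with
  one factor the identity, its independence of the basis.\<close>
lemma trace_wrt_comp_commute:
  assumes f: "endomorphism f" and g: "endomorphism g"
    and B: "independent B" "span B = UNIV" and C: "independent C" "span C = UNIV"
  shows "trace_wrt B (f \<circ> g) = trace_wrt C (g \<circ> f)"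
proof -
  have expand: "representation B' (f' (g' b)) b
      = (\<Sum>c\<in>C'. representation C' (g' b) c * representation B' (f' c) b)"
    if "endomorphism f'" "independent B'" "span B' = UNIV" "independent C'" "span C' = UNIV"
    for f' g' B' C' b
  proof -
    have "finite C'"
      using that finiteI_independent by auto
    then have "g' b = (\<Sum>c\<in>C'. representation C' (g' b) c *s c)"
      using that by (simp add: sum_representation_eq)
    then have "f' (g' b) = f' (\<Sum>c\<in>C'. representation C' (g' b) c *s c)"
      by simp
    then have "f' (g' b) = (\<Sum>c\<in>C'. representation C' (g' b) c *s f' c)"
      using that(1) by (simp add: endo.linear_sum endo.linear_scale)
    then show ?thesis
      using that by (simp add: representation_sum representation_scale)
  qed
  show ?thesis
    unfolding trace_wrt_def comp_def
    by (simp add: expand[OF f B C] expand[OF g C B] sum.swap[of _ B C] mult.commute)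
qed

lemma trace_comp_commute:
  "endomorphism f \<Longrightarrow> endomorphism g \<Longrightarrow> trace (f \<circ> g) = trace (g \<circ> f)"
  by (rule trace_wrt_comp_commute) (auto simp: independent_Basis span_Basis)

lemma trace_wrt_eq_trace:
  assumes "endomorphism f" "independent B" "span B = UNIV"
  shows "trace_wrt B f = trace f"
  using trace_wrt_comp_commute[of f id B Basis] assms linear_id
  by (simp add: independent_Basis span_Basis)

lemma trace_add: "trace (\<lambda>v. f v + g v) = trace f + trace g"
  by (simp add: trace_wrt_def representation_add independent_Basis span_Basis sum.distrib)

lemma trace_scale: "trace (\<lambda>v. c *s f v) = c * trace f"
  by (simp add: trace_wrt_def representation_scale independent_Basis span_Basis sum_distrib_left)

text \<open>In a basis that extends one of the range of \<open>e\<close>, the vectors of the range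
  contribute 1 each; every other basis vector is sent into the span of the former ones and
  contributes 0.\<close>
lemma trace_idempotent:
  assumes e: "endomorphism e" and idem: "\<And>v. e (e v) = e v"
  shows "trace e = of_nat (dim (range e))"
proof -
  have sub: "subspace (range e)"
    using e endo.linear_subspace_image subspace_UNIV by blast
  obtain C where C: "finite C" "C \<subseteq> range e" "independent C" "span C = range e"
      "card C = dim (range e)"
    using basis_subspace_exists[OF sub] by metis
  let ?B = "extend_basis C"
  have B: "independent ?B" "span ?B = UNIV" "C \<subseteq> ?B"
    using C independent_extend_basis span_extend_basis extend_basis_superset by auto
  then have fin: "finite ?B"
    using finiteI_independent by blast
  have "representation ?B (e b) b = (if b \<in> C then 1 else 0)" if b: "b \<in> ?B" for b
  proof (cases "b \<in> C")
    case True
    then have "e b = b"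
      using C(2) idem by auto
    then show ?thesis
      using True B b by (simp add: representation_basis)
  next
    case False
    have "e b \<in> span C"
      using C by auto
    then have "representation ?B (e b) = representation C (e b)"
      using representation_extend B by blast
    then show ?thesis
      using False representation_ne_zero by auto
  qed
  then have "trace_wrt ?B e = (\<Sum>b\<in>?B. if b \<in> C then 1 else 0)"
    unfolding trace_wrt_def by (rule sum.cong[OF refl])
  also have "\<dots> = of_nat (card C)"
    using fin B(3) by (simp add: Int_absorb1 flip: sum.inter_restrict)
  finally show ?thesis
    using trace_wrt_eq_trace e B C(5) by simp
qed

lemma endomorphism_funpow: "endomorphism a \<Longrightarrow> endomorphism (a ^^ n)"
  by (induction n) (auto simp: linear_id intro: Vector_Spaces.linear_compose)

text \<open>The powers of \<open>a\<close> lie in the finite-dimensional space of endomorphisms, so they satisfy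
  a linear relation; solving it for the lowest power that occurs expresses that power by higher
  ones.\<close>
lemma power_relation:
  assumes a: "endomorphism a"
  obtains n S c where "finite S" "S \<subseteq> {n<..}"
    "\<And>v. (a ^^ n) v = (\<Sum>k\<in>S. c k *s (a ^^ k) v)"
proof -
  interpret F: vector_space "\<lambda>c f v. c *s (f v :: 'v)"
    by unfold_locales (auto simp: fun_eq_iff scale_right_distrib scale_left_distrib)
  \<comment> \<open>the elementary matrices, which span the endomorphisms\<close>
  define E where "E = (\<lambda>(b, b') v. representation Basis v b *s b')"
  let ?E = "E ` (Basis \<times> Basis)"
  have sum_fun: "(\<Sum>i\<in>I. h i) v = (\<Sum>i\<in>I. h i v)" for I :: "'i set" and h :: "'i \<Rightarrow> 'v \<Rightarrow> 'v" and v
    by (induction I rule: infinite_finite_induct) auto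
  have in_span: "f \<in> F.span ?E" if f: "endomorphism f" for f
  proof -
    have "f v = (\<Sum>p\<in>Basis \<times> Basis. representation Basis (f (fst p)) (snd p) *s E p v)" for v
    proof -
      have "f v = f (\<Sum>b\<in>Basis. representation Basis v b *s b)"
        by (simp add: sum_representation_eq independent_Basis span_Basis finite_Basis)
      also have "\<dots> = (\<Sum>b\<in>Basis. representation Basis v b *s f b)"
        using f by (simp add: endo.linear_sum endo.linear_scale)
      also have "\<dots> = (\<Sum>b\<in>Basis. representation Basis v b *s
          (\<Sum>b'\<in>Basis. representation Basis (f b) b' *s b'))"
        by (simp add: sum_representation_eq independent_Basis span_Basis finite_Basis)
      also have "\<dots> = (\<Sum>b\<in>Basis. \<Sum>b'\<in>Basis. representation Basis (f b) b' *s E (b, b') v)"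
        by (simp add: E_def scale_sum_right mult.commute)
      finally show ?thesis
        by (simp add: sum.cartesian_product case_prod_beta)
    qed
    then have "f = (\<Sum>p\<in>Basis \<times> Basis. (\<lambda>v. representation Basis (f (fst p)) (snd p) *s E p v))"
      unfolding fun_eq_iff sum_fun by (rule allI)
    also have "\<dots> \<in> F.span ?E"
      by (intro F.span_sum F.span_scale F.span_base imageI)
    finally show ?thesis .
  qed
  define N where "N = card ?E"
  let ?P = "(\<lambda>k. a ^^ k) ` {..N}"
  \<comment> \<open>Linear dependence is a notion for sets, so coinciding powers are treated apart.\<close>
  show ?thesis
  proof (cases "inj_on (\<lambda>k. a ^^ k) {..N}")
    case False
    then obtain i j where "i < j" "a ^^ i = a ^^ j"
      by (metis inj_on_def linorder_neqE_nat)
    then show ?thesis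
      by (intro that[of "{j}" i "\<lambda>_. 1"]) auto
  next
    case True
    then have "card ?P > card ?E"
      by (simp add: card_image N_def)
    moreover have "?P \<subseteq> F.span ?E"
      using in_span endomorphism_funpow[OF a] by blast
    ultimately have "F.dependent ?P"
      using F.independent_span_bound[of ?E ?P] finite_Basis by auto
    then obtain u where u: "\<exists>f\<in>?P. u f \<noteq> 0" "(\<Sum>f\<in>?P. (\<lambda>v. u f *s f v)) = 0"
      using F.dependent_finite[of ?P] by auto
    let ?u = "\<lambda>k. u (a ^^ k)"
    have rel: "(\<Sum>k\<le>N. ?u k *s (a ^^ k) v) = 0" for v
    proof -
      have "(\<Sum>k\<le>N. ?u k *s (a ^^ k) v) = (\<Sum>f\<in>?P. (\<lambda>v. u f *s f v)) v"
        using True by (simp add: sum_fun sum.reindex)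
      then show ?thesis
        using u(2) by simp
    qed
    define n where "n = (LEAST k. k \<le> N \<and> ?u k \<noteq> 0)"
    have "\<exists>k. k \<le> N \<and> ?u k \<noteq> 0"
      using u(1) by auto
    then have n: "n \<le> N" "?u n \<noteq> 0"
      unfolding n_def by (rule LeastI2_ex; simp)+
    have below: "?u k = 0" if "k < n" for k
      using not_less_Least[of k "\<lambda>k. k \<le> N \<and> ?u k \<noteq> 0"] that n unfolding n_def by auto
    have "(a ^^ n) v = (\<Sum>k\<in>{n<..N}. (- ?u k / ?u n) *s (a ^^ k) v)" for v
    proof -
      have "{..N} = {..<n} \<union> insert n {n<..N}"
        using n by auto
      then have "(\<Sum>k\<le>N. ?u k *s (a ^^ k) v)
          = (\<Sum>k<n. ?u k *s (a ^^ k) v) + (\<Sum>k\<in>insert n {n<..N}. ?u k *s (a ^^ k) v)"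
        by (simp only:) (rule sum.union_disjoint; auto)
      then have "?u n *s (a ^^ n) v + (\<Sum>k\<in>{n<..N}. ?u k *s (a ^^ k) v) = 0"
        using rel[of v] below by simp
      then have eq: "?u n *s (a ^^ n) v = - (\<Sum>k\<in>{n<..N}. ?u k *s (a ^^ k) v)"
        by (simp only: eq_neg_iff_add_eq_0)
      have "(a ^^ n) v = (1 / ?u n) *s (?u n *s (a ^^ n) v)"
        using n by simp
      also have "\<dots> = (1 / ?u n) *s (- (\<Sum>k\<in>{n<..N}. ?u k *s (a ^^ k) v))"
        by (simp only: eq)
      finally show ?thesis
        by (simp add: scale_sum_right sum_negf scale_minus_left)
    qed
    then show ?thesis
      by (intro that[of "{n<..N}" n "\<lambda>k. - ?u k / ?u n"]) auto
  qed
qed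

text \<open>Write the relation between powers of \<open>a\<close> as \<open>a\<^sup>n = a\<^sup>n u\<close> with \<open>u = a r\<close> a
  polynomial in \<open>a\<close> without constant term, so that \<open>u \<in> A\<close>. As \<open>u\<^sup>n = r\<^sup>n a\<^sup>n\<close> absorbs
  \<open>u\<close> as well, \<open>u\<^sup>n\<close> is an idempotent. Its rank is its trace, which is 0; therefore \<open>u\<^sup>n = 0\<close>
  and \<open>a\<^sup>n = a\<^sup>n u\<^sup>n = 0\<close>.\<close>
lemma nilpotent_of_traceless_algebra:
  assumes A: "\<And>f. f \<in> A \<Longrightarrow> endomorphism f" "\<And>f. f \<in> A \<Longrightarrow> trace f = 0"
    and add: "\<And>f g. f \<in> A \<Longrightarrow> g \<in> A \<Longrightarrow> (\<lambda>v. f v + g v) \<in> A"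
    and scale: "\<And>c f. f \<in> A \<Longrightarrow> (\<lambda>v. c *s f v) \<in> A"
    and comp: "\<And>f g. f \<in> A \<Longrightarrow> g \<in> A \<Longrightarrow> f \<circ> g \<in> A"
    and a: "a \<in> A"
  obtains n where "\<And>v. (a ^^ n) v = 0"
proof -
  have lin: "endomorphism (a ^^ k)" for k
    using A(1) a endomorphism_funpow by blast
  obtain n S c where S: "finite S" "S \<subseteq> {n<..}"
    and rel: "\<And>v. (a ^^ n) v = (\<Sum>k\<in>S. c k *s (a ^^ k) v)"
    using power_relation A(1) a by metis
  define r where "r = (\<lambda>v. \<Sum>k\<in>S. c k *s (a ^^ (k - Suc n)) v)"
  define u where "u = a \<circ> r"
  have zero: "(\<lambda>v. 0) \<in> A"
    using scale[OF a, of 0] by simp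
  have sums: "(\<lambda>v. \<Sum>k\<in>T. f k v) \<in> A" if "finite T" "\<And>k. k \<in> T \<Longrightarrow> f k \<in> A" for T :: "nat set" and f
    using that by (induction T rule: finite_induct) (auto intro: zero add)
  have pow: "f ^^ Suc k \<in> A" if "f \<in> A" for f k
    using that comp by (induction k) auto
  have lin_a: "endomorphism a"
    using A(1) a by blast
  have ur: "u v = (\<Sum>k\<in>S. c k *s (a ^^ (k - n)) v)" for v
  proof -
    have "a ((a ^^ (k - Suc n)) v) = (a ^^ (k - n)) v" if "k \<in> S" for k
    proof -
      have "k - n = Suc (k - Suc n)"
        using that S(2) by auto
      then show ?thesis by simp
    qed
    then show ?thesis
      using lin_a by (simp add: u_def r_def endo.linear_sum endo.linear_scale)
  qed
  have u_in: "u \<in> A"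
  proof -
    have "(\<lambda>v. c k *s (a ^^ (k - n)) v) \<in> A" if "k \<in> S" for k
    proof -
      have "k - n = Suc (k - Suc n)"
        using that S(2) by auto
      then show ?thesis
        using pow[OF a] scale by metis
    qed
    then have "(\<lambda>v. \<Sum>k\<in>S. c k *s (a ^^ (k - n)) v) \<in> A"
      using S(1) by (rule sums[rotated])
    then show ?thesis
      using ur by presburger
  qed
  have absorb: "(a ^^ n) (u v) = (a ^^ n) v" for v
  proof -
    have "(a ^^ n) ((a ^^ (k - n)) v) = (a ^^ k) v" if "k \<in> S" for k
    proof -
      have "k = n + (k - n)"
        using that S(2) by auto
      then show ?thesis
        by (metis comp_apply funpow_add)
    qed
    then show ?thesis
      using lin by (simp add: ur rel[of v] endo.linear_sum endo.linear_scale)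
  qed
  have ra: "r (a v) = a (r v)" for v
    using lin_a by (simp add: r_def endo.linear_sum endo.linear_scale funpow_swap1)
  have rpa: "(r ^^ k) (a v) = a ((r ^^ k) v)" for k v
    by (induction k) (auto simp: ra)
  have upow: "(u ^^ k) v = (r ^^ k) ((a ^^ k) v)" for k v
    by (induction k) (auto simp: u_def rpa ra)
  have idem: "(u ^^ n) ((u ^^ k) v) = (u ^^ n) v" for k v
  proof (induction k arbitrary: v)
    case (Suc k)
    have "(u ^^ n) ((u ^^ Suc k) v) = (u ^^ n) ((u ^^ k) (u v))"
      by (simp add: funpow_swap1)
    also have "\<dots> = (u ^^ n) (u v)"
      using Suc .
    also have "\<dots> = (u ^^ n) v"
      by (simp add: upow absorb)
    finally show ?case .
  qed simp
  have absorb': "(a ^^ n) ((u ^^ k) v) = (a ^^ n) v" for k v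
    by (induction k) (auto simp: absorb)
  \<comment> \<open>This puts the idempotent into \<open>A\<close> even for \<open>n = 0\<close>, although \<open>A\<close> need not contain the identity.\<close>
  have "u ^^ n = u ^^ Suc n"
    using idem[of 1] by (auto simp: fun_eq_iff funpow_swap1)
  then have e: "u ^^ n \<in> A"
    using pow[OF u_in] by metis
  then have "of_nat (dim (range (u ^^ n))) = (0 :: 'k)"
    using trace_idempotent[of "u ^^ n"] A idem by simp
  then have "range (u ^^ n) \<subseteq> {0}"
    by simp
  then have "(u ^^ n) v = 0" for v
    by blast
  then have "(a ^^ n) v = 0" for v
    using absorb'[of n v] lin by (simp add: endo.linear_0)
  then show ?thesis
    by (rule that)
qed

end

section \<open>Invariant functionals on words in a perfect Lie algebra\<close>

context lie_algebra
begin

lemma bracket_linear: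
  "Vector_Spaces.linear scale scale (\<lambda>y. bracket x y)"
  "Vector_Spaces.linear scale scale (\<lambda>x. bracket x y)"
  using bilinear_bracket by (auto simp: bilinear_map_def)

lemma bracket_add:
  "bracket (x + y) z = bracket x z + bracket y z" "bracket x (y + z) = bracket x y + bracket x z"
  using bracket_linear[THEN Vector_Spaces.linear.axioms(3), THEN module_hom.add] by blast+

lemma bracket_scale:
  "bracket (scale c x) y = scale c (bracket x y)" "bracket x (scale c y) = scale c (bracket x y)"
  using bracket_linear[THEN Vector_Spaces.linear.axioms(3), THEN module_hom.scale] by blast+

lemma bracket_zero: "bracket 0 x = 0" "bracket x 0 = 0"
  using bracket_scale(1)[of 0 x x] bracket_scale(2)[of x 0 x] by simp_all

lemma bracket_anticommute: "bracket y x = - bracket x y"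
proof -
  have "bracket y x + bracket x y = 0"
    using bracket_self[of "x + y"] unfolding bracket_add by (simp add: bracket_self)
  then show ?thesis
    by (simp add: eq_neg_iff_add_eq_0)
qed

lemma bracket_minus:
  "bracket (- x) y = - bracket x y" "bracket x (- y) = - bracket x y"
  using bracket_scale(1)[of "-1" x y] bracket_scale(2)[of x "-1" y] by simp_all

lemma bracket_diff:
  "bracket (x - y) z = bracket x z - bracket y z" "bracket x (y - z) = bracket x y - bracket x z"
  using bracket_add[of x "- y" z] bracket_add[of x y "- z"] by (simp_all add: bracket_minus)

lemma jacobi_derivation:
  "bracket x (bracket y z) = bracket (bracket x y) z + bracket y (bracket x z)"
proof -
  have "bracket y (bracket z x) = - bracket y (bracket x z)"
    using bracket_anticommute[of z x] bracket_minus(2) by simp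
  moreover have "bracket z (bracket x y) = - bracket (bracket x y) z"
    by (rule bracket_anticommute)
  ultimately have "bracket x (bracket y z) - bracket y (bracket x z) - bracket (bracket x y) z = 0"
    using jacobi[of x y z] by simp
  then show ?thesis
    by (simp add: algebra_simps)
qed

end

text \<open>The functional \<open>t\<close> models the trace of a product of operators. In the induction step it is
  symmetric, since \<open>swap\<close> reduces an exchange of neighbours to a shorter word.
  Put \<open>f = t ([a,b], xs)\<close> with \<open>m\<close> entries in \<open>xs\<close>. Invariance under \<open>b\<close> and under \<open>a\<close>
  identifies the sums over \<open>i\<close> of \<open>t (a, \<dots>, [b, x\<^sub>i], \<dots>)\<close> and of \<open>t (b, \<dots>, [a, x\<^sub>i], \<dots>)\<close>
  as \<open>f\<close> and \<open>- f\<close>. The sum of the cubic identities for \<open>(a, b, x\<^sub>i)\<close> over all \<open>i\<close> then reads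
  \<open>m f + f + f = 0\<close>.\<close>
lemma (in lie_algebra) cyclic_functional_vanishes:
  fixes t :: "'g list \<Rightarrow> 'k"
  assumes char_0: "\<And>n. n > 0 \<Longrightarrow> of_nat n \<noteq> (0 :: 'k)"
    and perf: perfect
    and add: "\<And>x y zs. t ((x + y) # zs) = t (x # zs) + t (y # zs)"
    and scale: "\<And>c x zs. t (scale c x # zs) = c * t (x # zs)"
    and swap: "\<And>ws x y zs. t (ws @ x # y # zs) = t (ws @ y # x # zs) + t (ws @ bracket x y # zs)"
    and cyclic: "\<And>x zs. t (x # zs) = t (zs @ [x])"
    and cubic: "\<And>a b c zs. t (bracket a b # c # zs) + t (bracket b c # a # zs)
                  + t (bracket c a # b # zs) = 0"
    and ne: "xs \<noteq> []"
  shows "t xs = 0"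
proof -
  \<comment> \<open>moving \<open>b\<close> through a word produces its derivation action on the word\<close>
  have derivation: "t (ws @ b # zs) - t (ws @ zs @ [b])
      = (\<Sum>i<length zs. t (ws @ zs[i := bracket b (zs ! i)]))" for ws b zs
  proof (induction zs arbitrary: ws)
    case (Cons z zs)
    have "t (ws @ b # z # zs) - t (ws @ (z # zs) @ [b])
        = t (ws @ bracket b z # zs) + (t ((ws @ [z]) @ b # zs) - t ((ws @ [z]) @ zs @ [b]))"
      using swap[of ws b z zs] by simp
    also have "\<dots> = t (ws @ bracket b z # zs)
        + (\<Sum>i<length zs. t (ws @ z # zs[i := bracket b (zs ! i)]))"
      using Cons[of "ws @ [z]"] by simp
    finally show ?case
      by (simp add: sum.lessThan_Suc_shift del: sum.lessThan_Suc)
  qed simp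
  have invariant: "(\<Sum>i<length zs. t (zs[i := bracket b (zs ! i)])) = 0" for b zs
    using derivation[of "[]" b zs] cyclic[of b zs] by simp
  have "\<forall>xs. length xs = Suc n \<longrightarrow> t xs = 0" for n
  proof (induction n)
    case 0
    have "subspace {x. t [x] = 0}"
      using scale[of 0 0 "[]"] by (auto simp: subspace_def add scale)
    moreover have "t [bracket a b] = 0" for a b
      using swap[of "[]" a b "[]"] cyclic[of a "[b]"] by simp
    ultimately have "derived_algebra \<subseteq> {x. t [x] = 0}"
      unfolding derived_algebra_def by (intro span_minimal) auto
    then show ?case
      using perf by (auto simp: perfect_def length_Suc_conv)
  next
    case (Suc n)
    have exch: "t (ws @ x # y # zs) = t (ws @ y # x # zs)"
      if "length ws + length zs = n" for ws x y zs
      using swap[of ws x y zs] Suc that by simp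
    have move: "t (ws @ x # ys @ zs) = t (ws @ ys @ x # zs)"
      if "length ws + length ys + length zs = Suc n" for ws x ys zs
      using that
    proof (induction ys arbitrary: ws)
      case (Cons y ys)
      have "t (ws @ x # (y # ys) @ zs) = t ((ws @ [y]) @ x # ys @ zs)"
        using exch[of ws "ys @ zs" x y] Cons.prems by simp
      then show ?case
        using Cons.IH[of "ws @ [y]"] Cons.prems by simp
    qed simp
    have brackets: "t (bracket a b # xs) = 0" if len: "length xs = Suc n" for a b xs
    proof -
      let ?f = "t (bracket a b # xs)"
      have inv: "t (bracket y x # xs) + (\<Sum>i<Suc n. t (x # xs[i := bracket y (xs ! i)])) = 0" for x y
        using invariant[of "x # xs" y] len by (simp add: sum.lessThan_Suc_shift del: sum.lessThan_Suc)
      have neg: "t (bracket b a # xs) = - ?f"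
        using scale[of "-1" "bracket a b" xs] by (simp add: bracket_anticommute[of b a])
      have step: "?f + t (a # xs[i := bracket b (xs ! i)]) - t (b # xs[i := bracket a (xs ! i)]) = 0"
        if i: "i < Suc n" for i
      proof -
        define p q c where "p = take i xs" and "q = drop (Suc i) xs" and "c = xs ! i"
        have xs: "xs = p @ c # q" "\<And>y. xs[i := y] = p @ y # q"
          using i len by (auto simp: p_def q_def c_def id_take_nth_drop upd_conv_take_nth_drop)
        have pq: "length p + length q = n"
          using len xs(1) by simp
        have "t (bracket a b # c # p @ q) = ?f"
          using move[of "[bracket a b]" p q c] pq xs by simp
        moreover have "t (bracket b c # a # p @ q) = t (a # p @ bracket b c # q)"
          using move[of "[]" "a # p" q "bracket b c"] pq by simp
        moreover have "t (bracket c a # b # p @ q) = - t (b # p @ bracket a c # q)"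
          using move[of "[]" "b # p" q "bracket a c"] pq
            scale[of "-1" "bracket a c" "b # p @ q"] by (simp add: bracket_anticommute[of c a])
        ultimately show ?thesis
          using cubic[of a b c "p @ q"] xs(2) by (simp add: c_def)
      qed
      have "(\<Sum>i<Suc n. ?f + t (a # xs[i := bracket b (xs ! i)])
          - t (b # xs[i := bracket a (xs ! i)])) = 0"
        using step by (intro sum.neutral) blast
      then have "of_nat (Suc n) * ?f + (\<Sum>i<Suc n. t (a # xs[i := bracket b (xs ! i)]))
          - (\<Sum>i<Suc n. t (b # xs[i := bracket a (xs ! i)])) = 0"
        by (simp only: sum.distrib sum_subtractf sum_constant card_lessThan)
      moreover have "(\<Sum>i<Suc n. t (a # xs[i := bracket b (xs ! i)])) = ?f"
        using inv[of b a] neg by (simp add: eq_neg_iff_add_eq_0[symmetric] del: sum.lessThan_Suc)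
      moreover have "(\<Sum>i<Suc n. t (b # xs[i := bracket a (xs ! i)])) = - ?f"
        using inv[of a b] by (simp add: add_eq_0_iff del: sum.lessThan_Suc)
      ultimately have "of_nat (Suc n + 2) * ?f = 0"
        by (simp add: algebra_simps del: sum.lessThan_Suc)
      then show ?thesis
        using char_0[of "Suc n + 2"] by simp
    qed
    have "t (x # xs) = 0" if len: "length xs = Suc n" for x xs
    proof -
      have "subspace {x. t (x # xs) = 0}"
        using scale[of 0 0 xs] by (auto simp: subspace_def add scale)
      then have "derived_algebra \<subseteq> {x. t (x # xs) = 0}"
        unfolding derived_algebra_def using brackets[OF len] by (intro span_minimal) auto
      then show ?thesis
        using perf by (auto simp: perfect_def)
    qed
    then show ?case
      by (auto simp: length_Suc_conv)
  qed
  then show ?thesis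
    using ne by (cases xs) auto
qed


section \<open>Representations satisfying the standard identity of degree three\<close>

text \<open>In terms of the associative product of operators, the last axiom says that the alternating
  sum of the products of \<open>X a\<close>, \<open>X b\<close>, \<open>X c\<close> in all six orders is zero.\<close>
locale cubic_representation = char_0_space scale Basis + lie: lie_algebra lscale bracket
  for scale :: "'k::field_char_0 \<Rightarrow> 'v::ab_group_add \<Rightarrow> 'v" (infixr \<open>*s\<close> 75) and Basis
    and lscale :: "'k \<Rightarrow> 'g::ab_group_add \<Rightarrow> 'g" and bracket :: "'g \<Rightarrow> 'g \<Rightarrow> 'g" +
  fixes X :: "'g \<Rightarrow> 'v \<Rightarrow> 'v"
  assumes perfect: "lie_algebra.perfect lscale bracket"
    and endomorphism_X: "Vector_Spaces.linear scale scale (X x)"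
    and X_add: "X (x + y) v = X x v + X y v"
    and X_scale: "X (lscale k x) v = k *s X x v"
    and X_bracket: "X (bracket x y) v = X x (X y v) - X y (X x v)"
    and cubic_identity:
      "X (bracket a b) (X c v) + X (bracket b c) (X a v) + X (bracket c a) (X b v) = 0"
begin

definition word :: "'g list \<Rightarrow> 'v \<Rightarrow> 'v" where
  "word xs = foldr (\<lambda>x f. X x \<circ> f) xs id"

lemma word_simps: "word [] = id" "word (x # xs) = X x \<circ> word xs"
  by (simp_all add: word_def)

lemma word_append: "word (xs @ ys) = word xs \<circ> word ys"
  by (induction xs) (auto simp: word_simps)

lemma endomorphism_word: "endomorphism (word xs)"
proof (induction xs)
  case Nil
  show ?case
    unfolding word_simps by (rule linear_id)
next
  case (Cons x xs)
  then show ?case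
    unfolding word_simps using Vector_Spaces.linear_compose endomorphism_X by blast
qed

lemma trace_word:
  assumes "xs \<noteq> []"
  shows "trace (word xs) = 0"
proof (rule lie.cyclic_functional_vanishes[where t = "\<lambda>xs. trace (word xs)"])
  fix x y :: 'g and zs ws :: "'g list" and c :: 'k and a b d :: 'g
  show "trace (word ((x + y) # zs)) = trace (word (x # zs)) + trace (word (y # zs))"
    by (simp add: word_simps comp_def X_add trace_add)
  show "trace (word (lscale c x # zs)) = c * trace (word (x # zs))"
    by (simp add: word_simps comp_def X_scale trace_scale)
  have "word (ws @ x # y # zs) = (\<lambda>v. word (ws @ y # x # zs) v + word (ws @ bracket x y # zs) v)"
    using endomorphism_word[of ws]
    by (simp add: fun_eq_iff word_append word_simps X_bracket flip: endo.linear_add)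
  then show "trace (word (ws @ x # y # zs))
      = trace (word (ws @ y # x # zs)) + trace (word (ws @ bracket x y # zs))"
    by (simp only: trace_add)
  show "trace (word (x # zs)) = trace (word (zs @ [x]))"
    by (simp add: word_simps word_append trace_comp_commute endomorphism_X endomorphism_word)
  have "trace (\<lambda>v. word (bracket a b # d # zs) v + word (bracket b d # a # zs) v
      + word (bracket d a # b # zs) v) = 0"
    by (simp add: word_simps cubic_identity trace_wrt_def representation_zero)
  then show "trace (word (bracket a b # d # zs)) + trace (word (bracket b d # a # zs))
      + trace (word (bracket d a # b # zs)) = 0"
    by (simp only: trace_add)
qed (use assms perfect in auto)

text \<open>The associative algebra generated by the operators \<open>X x\<close>, without unit: only linear
  combinations of nonempty words are traceless.\<close>
inductive_set envelope :: "('v \<Rightarrow> 'v) set" where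
  generator: "X x \<in> envelope"
| comp: "f \<in> envelope \<Longrightarrow> X x \<circ> f \<in> envelope"
| add: "f \<in> envelope \<Longrightarrow> g \<in> envelope \<Longrightarrow> (\<lambda>v. f v + g v) \<in> envelope"
| scale: "f \<in> envelope \<Longrightarrow> (\<lambda>v. c *s f v) \<in> envelope"

lemma envelope_comp: "f \<in> envelope \<Longrightarrow> g \<in> envelope \<Longrightarrow> f \<circ> g \<in> envelope"
proof (induction rule: envelope.induct)
  case (generator x)
  then show ?case
    by (rule envelope.comp)
next
  case (comp f x)
  then show ?case
    using envelope.comp[of "f \<circ> g" x] unfolding comp_assoc by blast
next
  case (add f f')
  then show ?case
    using envelope.add[of "f \<circ> g" "f' \<circ> g"] by (simp add: comp_def)
next
  case (scale f c)
  then show ?case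
    using envelope.scale[of "f \<circ> g" c] by (simp add: comp_def)
qed

lemma endomorphism_envelope: "f \<in> envelope \<Longrightarrow> endomorphism f"
proof (induction rule: envelope.induct)
  case (comp f x)
  then show ?case
    using Vector_Spaces.linear_compose endomorphism_X by blast
qed (simp_all add: endomorphism_X endo.linear_compose_add endo.linear_compose_scale_right)

lemma trace_envelope:
  assumes "f \<in> envelope"
  shows "trace f = 0"
proof -
  \<comment> \<open>The prefix \<open>ws\<close> lets the induction pass through the rule that multiplies from the left.\<close>
  have "trace (word ws \<circ> f) = 0" for ws
    using assms
  proof (induction arbitrary: ws rule: envelope.induct)
    case (generator x)
    then show ?case
      using trace_word[of "ws @ [x]"] by (simp add: word_append word_simps comp_def)
  next
    case (comp f x)
    then show ?case
      using comp.IH[of "ws @ [x]"] by (simp add: word_append word_simps comp_assoc)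
  next
    case (add f g)
    then show ?case
      using endomorphism_word[of ws] by (simp add: comp_def endo.linear_add trace_add)
  next
    case (scale f c)
    then show ?case
      using endomorphism_word[of ws] by (simp add: comp_def endo.linear_scale trace_scale)
  qed
  from this[of "[]"] show ?thesis
    by (simp add: word_simps)
qed

lemma envelope_nilpotent:
  assumes "a \<in> envelope"
  obtains n where "\<And>v. (a ^^ n) v = 0"
proof (rule nilpotent_of_traceless_algebra[OF endomorphism_envelope trace_envelope])
  show "a \<in> envelope" by fact
qed (auto intro: that envelope_comp envelope.add envelope.scale)

text \<open>Let \<open>M\<close> be a maximal proper submodule of \<open>J\<close> and \<open>v \<in> J\<close>. If the submodule \<open>N\<close> formed from
  \<open>M\<close> and the orbit of \<open>v\<close> under the envelope were all of \<open>J\<close>, then \<open>v = a v\<close> modulo \<open>M\<close> for some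
  \<open>a\<close> in the envelope; iterating with \<open>a\<close> nilpotent puts \<open>v\<close> and so \<open>N\<close> into \<open>M\<close>. Hence
  \<open>N = M\<close>, that is, the operators map \<open>J\<close> into \<open>M\<close>, and the elements of this form span \<open>J\<close>.\<close>
lemma generated_submodule_trivial:
  assumes J: "subspace J" "\<And>x v. v \<in> J \<Longrightarrow> X x v \<in> J"
    and gen: "J \<subseteq> span {X x v | x v. v \<in> J}"
  shows "J = {0}"
proof (rule ccontr)
  assume ne: "J \<noteq> {0}"
  define P where "P M \<longleftrightarrow> subspace M \<and> M \<subseteq> J \<and> M \<noteq> J \<and> (\<forall>x. \<forall>v\<in>M. X x v \<in> M)" for M
  have "P {0}"
    using ne J subspace_0 endomorphism_X by (auto simp: P_def endo.linear_0)
  moreover have "\<forall>M. P M \<longrightarrow> dim M < Suc dimension"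
    using dim_subset_UNIV by (simp add: less_Suc_eq_le)
  ultimately obtain M where M: "P M" and max: "\<And>M'. P M' \<Longrightarrow> dim M' \<le> dim M"
    using ex_has_greatest_nat[of P "{0}" dim "Suc dimension"] by blast
  have subM: "subspace M" "M \<subseteq> J" "M \<noteq> J" and XM: "\<And>x v. v \<in> M \<Longrightarrow> X x v \<in> M"
    using M by (auto simp: P_def)
  have inv: "f v \<in> K" if "f \<in> envelope" "v \<in> K" "subspace K" "\<And>x v. v \<in> K \<Longrightarrow> X x v \<in> K" for f v K
    using that by (induction arbitrary: v rule: envelope.induct)
      (auto intro: subspace_add subspace_scale)
  have step: "X x v \<in> M" if v: "v \<in> J" for x v
  proof -
    define N where "N = {f v + w | f w. f \<in> envelope \<and> w \<in> M}"
    have N_I: "f v + w \<in> N" if "f \<in> envelope" "w \<in> M" for f w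
      using that unfolding N_def by blast
    have N_E: "\<exists>f w. f \<in> envelope \<and> w \<in> M \<and> p = f v + w" if "p \<in> N" for p
      using that unfolding N_def by blast
    have zero: "(\<lambda>v. 0) \<in> envelope"
      using envelope.scale[OF envelope.generator, of 0] by simp
    have subN: "subspace N"
      unfolding subspace_def
    proof (intro conjI ballI allI)
      show "0 \<in> N"
        using N_I[OF zero subspace_0[OF subM(1)]] by simp
    next
      fix p q assume "p \<in> N" "q \<in> N"
      then obtain f w g w' where *: "f \<in> envelope" "w \<in> M" "g \<in> envelope" "w' \<in> M"
          "p = f v + w" "q = g v + w'"
        using N_E[of p] N_E[of q] by blast
      then have "p + q = (f v + g v) + (w + w')"
        by (simp add: algebra_simps)
      then show "p + q \<in> N"
        using N_I[OF envelope.add[of f g] subspace_add[OF subM(1)]] * by metis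
    next
      fix c p assume "p \<in> N"
      then obtain f w where *: "f \<in> envelope" "w \<in> M" "p = f v + w"
        using N_E by blast
      then have "c *s p = (c *s f v) + c *s w"
        by (simp add: scale_right_distrib)
      then show "c *s p \<in> N"
        using N_I[OF envelope.scale[of f c] subspace_scale[OF subM(1)]] * by metis
    qed
    have XN: "X y p \<in> N" if p: "p \<in> N" for y p
    proof -
      obtain f w where *: "f \<in> envelope" "w \<in> M" "p = f v + w"
        using N_E[OF p] by blast
      then have "X y p = (X y \<circ> f) v + X y w"
        using endomorphism_X by (simp add: endo.linear_add)
      then show ?thesis
        using N_I[OF envelope.comp[of f y] XM] * by metis
    qed
    have MN: "M \<subseteq> N"
      using N_I[OF zero] by auto
    have NJ: "N \<subseteq> J"
    proof
      fix p assume "p \<in> N"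
      then obtain f w where "f \<in> envelope" "w \<in> M" "p = f v + w"
        using N_E by blast
      then show "p \<in> J"
        using inv[of f v J] v J subM(2) subspace_add[OF J(1)] by blast
    qed
    have "N \<noteq> J"
    proof
      assume "N = J"
      then have "v \<in> N"
        using v by simp
      then obtain a w where a: "a \<in> envelope" and w: "w \<in> M" "v = a v + w"
        using N_E by blast
      obtain n where n: "\<And>u. (a ^^ n) u = 0"
        using envelope_nilpotent[OF a] by blast
      have "v - (a ^^ k) v \<in> M" for k
      proof (induction k)
        case (Suc k)
        have "a v - a ((a ^^ k) v) \<in> M"
          using inv[OF a Suc subM(1) XM] endomorphism_envelope[OF a] by (simp add: endo.linear_diff)
        then have "w + (a v - a ((a ^^ k) v)) \<in> M"
          using subspace_add[OF subM(1)] w(1) by blast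
        moreover have "w + (a v - a ((a ^^ k) v)) = v - (a ^^ Suc k) v"
          using w(2) by (simp add: algebra_simps)
        ultimately show ?case
          by simp
      qed (use subspace_0[OF subM(1)] in simp)
      from this[of n] have "v \<in> M"
        using n by simp
      have "N \<subseteq> M"
      proof
        fix p assume "p \<in> N"
        then obtain f w where "f \<in> envelope" "w \<in> M" "p = f v + w"
          using N_E by blast
        then show "p \<in> M"
          using inv[of f v M] \<open>v \<in> M\<close> subM(1) XM subspace_add[OF subM(1)] by blast
      qed
      then show False
        using \<open>N = J\<close> subM by blast
    qed
    then have "P N"
      using subN NJ XN by (auto simp: P_def)
    then have "N = M"
      using subspace_dim_equal[OF subM(1) subN MN] max by simp
    moreover have "X x v + 0 \<in> N"
      using N_I[OF envelope.generator subspace_0[OF subM(1)]] .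
    ultimately show ?thesis
      by simp
  qed
  have "J \<subseteq> M"
    using gen span_minimal[of "{X x v | x v. v \<in> J}" M] subM(1) step by blast
  then show False
    using subM by blast
qed

end

section \<open>Symmetric biderivations\<close>

context lie_algebra
begin

definition ideal :: "'g set \<Rightarrow> bool" where
  "ideal I \<longleftrightarrow> subspace I \<and> (\<forall>x. \<forall>v\<in>I. bracket x v \<in> I)"

text \<open>The standard polynomial of degree three, evaluated at \<open>ad a\<close>, \<open>ad b\<close>, \<open>ad c\<close> and
  applied to \<open>v\<close>.\<close>
definition cubic :: "'g \<Rightarrow> 'g \<Rightarrow> 'g \<Rightarrow> 'g \<Rightarrow> 'g" where
  "cubic a b c v = bracket (bracket a b) (bracket c v) + bracket (bracket b c) (bracket a v)
     + bracket (bracket c a) (bracket b v)"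

text \<open>Equivariance of the cubic expression; it makes the vectors that all cubics kill an ideal.\<close>
lemma bracket_cubic:
  "bracket x (cubic a b c v) = cubic (bracket x a) b c v + cubic a (bracket x b) c v
     + cubic a b (bracket x c) v + cubic a b c (bracket x v)"
proof -
  have "bracket x (bracket (bracket p q) (bracket r v))
      = bracket (bracket (bracket x p) q) (bracket r v)
        + bracket (bracket p (bracket x q)) (bracket r v)
        + bracket (bracket p q) (bracket (bracket x r) v)
        + bracket (bracket p q) (bracket r (bracket x v))" for p q r
    using jacobi_derivation[of x "bracket p q" "bracket r v"] jacobi_derivation[of x p q]
      jacobi_derivation[of x r v] by (simp add: bracket_add)
  then show ?thesis
    by (simp add: cubic_def bracket_add add_ac)
qed

lemma ideal_cubic_annihilator: "ideal {v. \<forall>a b c. cubic a b c v = 0}"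
proof -
  have "cubic a b c (bracket x v) = 0" if "\<forall>a b c. cubic a b c v = 0" for a b c x v
    using bracket_cubic[of x a b c v] that by (simp add: bracket_zero)
  moreover have "cubic a b c (v + w) = cubic a b c v + cubic a b c w" for a b c v w
    by (simp add: cubic_def bracket_add add_ac)
  moreover have "cubic a b c (scale k v) = scale k (cubic a b c v)" for a b c k v
    by (simp add: cubic_def bracket_scale scale_right_distrib)
  moreover have "cubic a b c 0 = 0" for a b c
    by (simp add: cubic_def bracket_zero)
  ultimately show ?thesis
    by (auto simp: ideal_def subspace_def)
qed

context
  fixes m :: "'g \<Rightarrow> 'g \<Rightarrow> 'g"
  assumes ABD: "ABD_structure m"
begin

lemma ABD_commute: "m x y = m y x"
  using ABD by (auto simp: ABD_structure_def)

lemma ABD_linear: "Vector_Spaces.linear scale scale (\<lambda>x. m x y)"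
  using ABD by (auto simp: ABD_structure_def bilinear_map_def)

lemma ABD_derivation: "m x (bracket y z) = bracket (m x y) z + bracket y (m x z)"
  using ABD by (auto simp: ABD_structure_def)

lemma ABD_cocycle: "m (bracket x y) z = bracket x (m y z) - bracket y (m x z)"
  using ABD_derivation[of z x y] bracket_anticommute[of "m z x" y] ABD_commute
  by (metis add.commute diff_conv_add_uminus)

text \<open>Expand both sides of \<open>m [a,c] [b,d] = m [b,d] [a,c]\<close> by the cocycle rule; the double brackets
  combine in pairs through the Jacobi identity.\<close>
lemma ABD_four_cycle:
  "bracket (bracket a b) (m c d) + bracket (bracket b c) (m d a)
     + bracket (bracket c d) (m a b) + bracket (bracket d a) (m b c) = 0"
proof -
  have expand: "m (bracket p r) (bracket q s)
      = bracket p (bracket q (m r s)) - bracket p (bracket s (m q r))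
        - bracket r (bracket q (m p s)) + bracket r (bracket s (m p q))" for p q r s
    by (simp add: ABD_cocycle[of p r] ABD_cocycle[of q s] ABD_commute[of r "bracket q s"]
        ABD_commute[of p "bracket q s"] ABD_commute[of s r] ABD_commute[of s p]
        ABD_commute[of q p] bracket_diff)
  have commutator: "bracket (bracket p q) v = bracket p (bracket q v) - bracket q (bracket p v)"
    for p q v
    using jacobi_derivation[of p q v] by simp
  show ?thesis
    using expand[of a c b d] expand[of b d a c] ABD_commute[of "bracket a c" "bracket b d"]
    by (simp add: commutator ABD_commute[of d a] ABD_commute[of d c] ABD_commute[of c b]
        ABD_commute[of b a] algebra_simps)
qed

text \<open>View \<open>[[p,q], m r s]\<close> as a value on the oriented edge from \<open>p\<close> to \<open>q\<close> of the complete graph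
  on the four arguments. The sum of three 4-cycles is twice a triangle.\<close>
lemma ABD_triangle:
  assumes two: "(2 :: 'k) \<noteq> 0"
  shows "bracket (bracket a b) (m c d) + bracket (bracket b c) (m a d)
     + bracket (bracket c a) (m b d) = 0" (is "?T = 0")
proof -
  have "scale 2 ?T = ?T + ?T"
    by (metis one_add_one scale_left_distrib scale_one)
  also have "\<dots> = (bracket (bracket a b) (m c d) + bracket (bracket b c) (m d a)
        + bracket (bracket c d) (m a b) + bracket (bracket d a) (m b c))
      + (bracket (bracket b c) (m a d) + bracket (bracket c a) (m d b)
        + bracket (bracket a d) (m b c) + bracket (bracket d b) (m c a))
      + (bracket (bracket c a) (m b d) + bracket (bracket a b) (m d c)
        + bracket (bracket b d) (m c a) + bracket (bracket d c) (m a b))"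
    by (simp add: bracket_anticommute[of d] bracket_minus ABD_commute[of d] algebra_simps)
  also have "\<dots> = 0"
    by (simp only: ABD_four_cycle add_0)
  finally show ?thesis
    using two by (simp only: scale_eq_0_iff) simp
qed

text \<open>Apply \<open>ad x\<close> to the triangle identity. By the cocycle rule
  \<open>[x, m c d] = m [x,c] d + [c, m x d]\<close>, the result consists of triangle identities for the
  modified arguments and of the cubic expression in \<open>m x d\<close>.\<close>
lemma cubic_ABD:
  assumes two: "(2 :: 'k) \<noteq> 0"
  shows "cubic a b c (m x d) = 0"
proof -
  define T where "T a b c = bracket (bracket a b) (m c d) + bracket (bracket b c) (m a d)
     + bracket (bracket c a) (m b d)" for a b c
  have T: "T a b c = 0" for a b c
    unfolding T_def using ABD_triangle[OF two] .
  have "bracket x (bracket (bracket p q) (m r d))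
      = bracket (bracket (bracket x p) q) (m r d)
        + bracket (bracket p (bracket x q)) (m r d)
        + bracket (bracket p q) (m (bracket x r) d)
        + bracket (bracket p q) (bracket r (m x d))" for p q r
    using jacobi_derivation[of x "bracket p q" "m r d"] jacobi_derivation[of x p q]
      ABD_cocycle[of x r d] by (simp add: bracket_add bracket_diff)
  then have "bracket x (T a b c) = T (bracket x a) b c + T a (bracket x b) c
      + T a b (bracket x c) + cubic a b c (m x d)"
    by (simp add: cubic_def T_def bracket_add add_ac)
  then show ?thesis
    by (simp add: T bracket_zero)
qed

definition ABD_ideal :: "'g set" where
  "ABD_ideal = \<Inter> {I. ideal I \<and> (\<forall>x y. m x y \<in> I)}"

lemma ABD_in_ideal: "m x y \<in> ABD_ideal"
  by (auto simp: ABD_ideal_def)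

lemma ideal_ABD_ideal: "ideal ABD_ideal"
  unfolding ABD_ideal_def ideal_def by (auto intro: subspace_Inter)

lemma ABD_ideal_least: "ideal I \<Longrightarrow> (\<And>x y. m x y \<in> I) \<Longrightarrow> ABD_ideal \<subseteq> I"
  by (auto simp: ABD_ideal_def)

text \<open>The span on the right is itself an ideal, and for \<open>x = [a,b]\<close> the cocycle rule writes
  \<open>m x y\<close> as a difference of two brackets with elements of the ideal; perfectness supplies all other
  \<open>x\<close>. Minimality of \<open>ABD_ideal\<close> does the rest.\<close>
lemma ABD_ideal_generated:
  assumes perfect
  shows "ABD_ideal \<subseteq> span {bracket x v | x v. v \<in> ABD_ideal}" (is "_ \<subseteq> ?I")
proof (rule ABD_ideal_least)
  have sub: "?I \<subseteq> ABD_ideal"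
    using ideal_ABD_ideal by (intro span_minimal) (auto simp: ideal_def)
  show "ideal ?I"
    unfolding ideal_def using sub by (auto intro: span_base)
  show "m x y \<in> ?I" for x y
  proof -
    have "subspace {x. m x y \<in> ?I}"
      using Vector_Spaces.linear.axioms(3)[OF ABD_linear] subspace_span
        module_hom.subspace_vimage[of scale scale "\<lambda>x. m x y" ?I]
      by (simp add: vimage_def)
    moreover have "m (bracket a b) y \<in> ?I" for a b
      unfolding ABD_cocycle using ABD_in_ideal by (intro span_diff span_base) blast+
    ultimately have "derived_algebra \<subseteq> {x. m x y \<in> ?I}"
      unfolding derived_algebra_def by (intro span_minimal) auto
    then show ?thesis
      using assms by (auto simp: perfect_def)
  qed
qed

end

end

theorem theorem5p1:
  fixes scale :: "'k::field_char_0 \<Rightarrow> 'g::ab_group_add \<Rightarrow> 'g"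
    and bracket m :: "'g \<Rightarrow> 'g \<Rightarrow> 'g"
  assumes "lie_algebra scale bracket"
    and "\<exists>B. finite_dimensional_vector_space scale B"
    and "lie_algebra.perfect scale bracket"
    and "lie_algebra.ABD_structure scale bracket m"
  shows "\<forall>x y. m x y = 0"
proof -
  obtain B where B: "finite_dimensional_vector_space scale B"
    using assms(2) by blast
  interpret lie_algebra scale bracket by fact
  interpret char_0_space scale B
    using B by (simp add: char_0_space_def)
  note ABD = assms(4)
  let ?J = "ABD_ideal m"
  have J: "subspace ?J" "\<And>x v. v \<in> ?J \<Longrightarrow> bracket x v \<in> ?J"
    using ideal_ABD_ideal[OF ABD] by (auto simp: ideal_def)
  have cubic_J: "cubic a b c v = 0" if "v \<in> ?J" for a b c v
    using ABD_ideal_least[OF ABD ideal_cubic_annihilator] cubic_ABD[OF ABD] that by auto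
  \<comment> \<open>Precomposing with a projection \<open>p\<close> onto the ideal turns the action on the ideal into a
    representation on the whole space, where traces are available.\<close>
  obtain p where p: "Vector_Spaces.linear scale scale p" "\<And>v. p v \<in> ?J" "\<And>v. v \<in> ?J \<Longrightarrow> p v = v"
    using endo.linear_exists_left_inverse_on[OF linear_id J(1)] by auto
  interpret rep: cubic_representation scale B scale bracket "\<lambda>x v. bracket x (p v)"
  proof (intro cubic_representation.intro cubic_representation_axioms.intro)
    fix x y v a b c :: 'g
    show "Vector_Spaces.linear scale scale (\<lambda>v. bracket x (p v))"
      using Vector_Spaces.linear_compose[OF p(1) bracket_linear(1)] by (simp add: comp_def)
    show "bracket (bracket x y) (p v) = bracket x (p (bracket y (p v))) - bracket y (p (bracket x (p v)))"
      using p J(2) jacobi_derivation[of x y "p v"] by simp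
    show "bracket (bracket a b) (p (bracket c (p v))) + bracket (bracket b c) (p (bracket a (p v)))
        + bracket (bracket c a) (p (bracket b (p v))) = 0"
      using p J(2) cubic_J[of "p v" a b c] by (simp add: cubic_def)
  qed (use assms(3) in \<open>auto simp: bracket_add bracket_scale lie_algebra_axioms char_0_space_axioms\<close>)
  have "{bracket x (p v) | x v. v \<in> ?J} = {bracket x v | x v. v \<in> ?J}"
    using p by (metis (no_types, lifting))
  then have "?J = {0}"
    using rep.generated_submodule_trivial[of ?J] J p ABD_ideal_generated[OF ABD assms(3)] by simp
  then show ?thesis
    using ABD_in_ideal[OF ABD] by blast
qed

end
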